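(* For every finite group $H$ there is a finite DEG-group $G$ that contains (an isomorphic copy of) $H$ as a normal subgroup.
   Context: A subset $D$ of a group $G$ is a determining set of $G$ if the only automorphism of $G$ that fixes every element of $D$ is the identity automorphism. The determining number $\alpha(G)$ is the cardinality of a smallest determining set of $G$ ($\alpha(G)=0$ if $G$ has only the identity automorphism). The generating number $\gamma(G)$ is the cardinality of a smallest generating set of $G$ (the trivial group has generating number $0$). A group $G$ is a DEG-group if $\alpha(G)=\gamma(G)$. *)

theory Defs
  imports "HOL-Algebra.Bij" "HOL-Algebra.Generated_Groups"
begin

definition determining_set :: "('a, 'b) monoid_scheme \<Rightarrow> 'a set \<Rightarrow> bool" where
  "determining_set G D \<longleftrightarrow> D \<subseteq> carrier G \<and>
     (\<forall>f \<in> auto G. (\<forall>d\<in>D. f d = d) \<longrightarrow> f = (\<lambda>x\<in>carrier G. x))"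

definition generating_set :: "('a, 'b) monoid_scheme \<Rightarrow> 'a set \<Rightarrow> bool" where
  "generating_set G S \<longleftrightarrow> S \<subseteq> carrier G \<and> generate G S = carrier G"

text \<open>
  The two numbers below are natural numbers and are meaningful only for groups that have a
  finite determining set, respectively a finite generating set (in particular for all finite
  groups); otherwise \<open>LEAST\<close> ranges over an empty predicate and its value is unspecified.
\<close>

definition determining_number :: "('a, 'b) monoid_scheme \<Rightarrow> nat" where
  "determining_number G = (LEAST n. \<exists>D. determining_set G D \<and> finite D \<and> card D = n)"

definition generating_number :: "('a, 'b) monoid_scheme \<Rightarrow> nat" where
  "generating_number G = (LEAST n. \<exists>S. generating_set G S \<and> finite S \<and> card S = n)"

definition DEG_group :: "('a, 'b) monoid_scheme \<Rightarrow> bool" where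
  "DEG_group G \<longleftrightarrow> group G \<and> determining_number G = generating_number G"

end

theory Submission
  imports Defs "HOL-Algebra.Multiplicative_Group" "HOL-Algebra.Product_Groups"
    "HOL-Number_Theory.Cong"
begin

text \<open>
  The idea is to swamp \<open>H\<close> by a large vector space.  Let \<open>p\<close> be an odd prime larger than
  \<open>|H|\<close> and let \<open>V\<close> be the space of functions from \<open>H\<close> to the field with \<open>p\<close> elements, so
  that \<open>V\<close> has dimension \<open>|H|\<close>.  The direct product \<open>G = H \<times> V\<close> contains \<open>H\<close> as a normal
  factor, and both of its numbers equal \<open>|H|\<close>.

  The generating number is at most \<open>|H|\<close>: pair each element \<open>h\<close> of \<open>H\<close> with the unit vector
  \<open>e\<^sub>h\<close>.  Since the orders of \<open>H\<close> and \<open>V\<close> are coprime, a suitable power of \<open>(h, e\<^sub>h)\<close> is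
  \<open>(h, 0)\<close>, so these \<open>|H|\<close> pairs generate both factors at once
  (\<open>subgroup_DirProd_coprime_fst\<close>, \<open>generate_unit_vecs\<close>).

  The determining number is at least \<open>|H|\<close>: every automorphism of \<open>V\<close> extends to \<open>G\<close> by the
  identity on \<open>H\<close>, so a determining set of \<open>G\<close> projects to one of \<open>V\<close>.  Fewer than \<open>dim V\<close>
  vectors are annihilated by some nonzero linear functional \<open>\<phi>\<close>
  (\<open>exists_annihilating_functional\<close>), and then \<open>v \<mapsto> v \<plusminus> \<phi>(v) e\<close>, for a suitable sign and unit
  vector \<open>e\<close>, is a nontrivial automorphism of \<open>V\<close> that fixes all of them.

  Since generating sets are determining, the determining number never exceeds the generating
  number, and the two bounds force equality.
\<close>

section \<open>Comparing the two numbers\<close>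

lemma auto_iff: "f \<in> auto G \<longleftrightarrow> f \<in> iso G G \<and> f \<in> extensional (carrier G)"
  by (auto simp: auto_def iso_def Bij_def)

lemma restrict_iso_in_auto:
  assumes "group G" "f \<in> iso G G"
  shows "restrict f (carrier G) \<in> auto G"
proof -
  interpret group G by fact
  have "bij_betw (restrict f (carrier G)) (carrier G) (carrier G)"
    using assms(2) by (subst bij_betw_cong[of _ _ f]) (auto simp: iso_def)
  then show ?thesis
    using assms(2) by (auto simp: auto_def Bij_def iso_def hom_def)
qed

text \<open>An automorphism is determined by its values on generators: those on which it agrees with
  the identity form a subgroup.\<close>

lemma generating_imp_determining:
  assumes "group G" "generating_set G S"
  shows "determining_set G S"
  unfolding determining_set_def
proof (intro conjI ballI impI)
  show S: "S \<subseteq> carrier G"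
    using assms(2) by (simp add: generating_set_def)
  fix f assume f: "f \<in> auto G" and fix_S: "\<forall>d\<in>S. f d = d"
  interpret group G by fact
  interpret f: group_hom G G f
    using f by unfold_locales (auto simp: auto_def)
  have "f x = x" if "x \<in> generate G S" for x
    using that
  proof induction
    case (inv h)
    then show ?case using S fix_S f.hom_inv[of h] by auto
  next
    case (eng h1 h2)
    then show ?case using generate_in_carrier[OF S] by simp
  qed (use fix_S in auto)
  then show "f = (\<lambda>x\<in>carrier G. x)"
    using assms(2) f by (intro extensionalityI[of _ "carrier G"])
      (auto simp: generating_set_def auto_iff)
qed

text \<open>A generating set that is no larger than any determining set pins down both numbers.\<close>

lemma DEG_groupI:
  assumes "group G" "generating_set G S" "finite S"
    and least: "\<And>D. determining_set G D \<Longrightarrow> finite D \<Longrightarrow> card S \<le> card D"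
  shows "DEG_group G"
proof -
  have "determining_number G = card S"
    unfolding determining_number_def
    using generating_imp_determining[OF assms(1,2)] assms(3) least
    by (intro Least_equality) auto
  moreover have "generating_number G = card S"
    unfolding generating_number_def
    using generating_imp_determining[OF assms(1)] assms(2,3) least
    by (intro Least_equality) auto
  ultimately show ?thesis
    using assms(1) by (simp add: DEG_group_def)
qed

section \<open>Invariance under isomorphism\<close>

lemma generating_set_iso:
  assumes "group G" "group K" "f \<in> iso G K" "generating_set G S"
  shows "generating_set K (f ` S)"
proof -
  interpret f: group_hom G K f
    using assms by (auto simp: group_hom_def group_hom_axioms_def iso_def)
  show ?thesis
    using assms f.generate_img[of S]
    by (auto simp: generating_set_def iso_def bij_betw_def)
qed

text \<open>Conjugation by the isomorphism turns an automorphism of \<open>K\<close> that fixes the image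
  pointwise into an automorphism of \<open>G\<close> that fixes the original set pointwise.\<close>

lemma determining_set_iso:
  assumes "group G" "group K" "f \<in> iso G K" "determining_set G D"
  shows "determining_set K (f ` D)"
  unfolding determining_set_def
proof (intro conjI ballI impI)
  have bij: "bij_betw f (carrier G) (carrier K)"
    using assms(3) by (simp add: iso_def)
  have D: "D \<subseteq> carrier G"
    using assms(4) by (simp add: determining_set_def)
  then show "f ` D \<subseteq> carrier K"
    using bij by (auto simp: bij_betw_def)
  fix s assume s: "s \<in> auto K" and fix_D: "\<forall>d\<in>f ` D. s d = d"
  define g where "g = inv_into (carrier G) f"
  have g: "g \<in> iso K G"
    using assms(1,3) by (simp add: g_def group.iso_set_sym)
  have gf: "g (f x) = x" if "x \<in> carrier G" for x
    using that bij by (simp add: g_def bij_betw_inv_into_left)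
  have fg: "f (g y) = y" if "y \<in> carrier K" for y
    using that bij by (simp add: g_def bij_betw_inv_into_right)
  define t where "t = restrict (g \<circ> (s \<circ> f)) (carrier G)"
  have "g \<circ> (s \<circ> f) \<in> iso G G"
    using assms(3) s g by (auto simp: auto_iff intro!: iso_set_trans)
  then have "t \<in> auto G"
    unfolding t_def by (rule restrict_iso_in_auto[OF assms(1)])
  moreover have "\<forall>d\<in>D. t d = d"
    using D fix_D gf by (auto simp: t_def)
  ultimately have t: "t = (\<lambda>x\<in>carrier G. x)"
    using assms(4) by (auto simp: determining_set_def)
  have "s y = y" if y: "y \<in> carrier K" for y
  proof -
    have "g y \<in> carrier G" "s y \<in> carrier K"
      using y g s by (auto simp: auto_iff iso_def bij_betw_def)
    then have "g (s y) = g y"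
      using fun_cong[OF t, of "g y"] y by (simp add: t_def fg)
    then show ?thesis
      using fg[OF y] fg[OF \<open>s y \<in> carrier K\<close>] by metis
  qed
  then show "s = (\<lambda>x\<in>carrier K. x)"
    using s by (intro extensionalityI[of _ "carrier K"]) (auto simp: auto_iff)
qed

lemma DEG_group_iso:
  assumes "group G" "group K" "f \<in> iso G K" "DEG_group G"
  shows "DEG_group K"
proof -
  let ?g = "inv_into (carrier G) f"
  have g: "?g \<in> iso K G"
    using assms(1,3) by (simp add: group.iso_set_sym)
  have card_f: "card (f ` A) = card A" if "A \<subseteq> carrier G" for A
    using that assms(3) by (intro card_image) (auto simp: iso_def bij_betw_def intro: inj_on_subset)
  have card_g: "card (?g ` A) = card A" if "A \<subseteq> carrier K" for A
    using that g by (intro card_image) (auto simp: iso_def bij_betw_def intro: inj_on_subset)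
  have "(\<exists>D. determining_set G D \<and> finite D \<and> card D = n) \<longleftrightarrow>
        (\<exists>D. determining_set K D \<and> finite D \<and> card D = n)" for n
  proof safe
    fix D assume "determining_set G D" "finite D"
    then show "\<exists>E. determining_set K E \<and> finite E \<and> card E = card D"
      by (intro exI[of _ "f ` D"])
        (auto simp: card_f determining_set_def[of G] intro: determining_set_iso[OF assms(1,2,3)])
  next
    fix D assume "determining_set K D" "finite D"
    then show "\<exists>E. determining_set G E \<and> finite E \<and> card E = card D"
      by (intro exI[of _ "?g ` D"])
        (auto simp: card_g determining_set_def[of K] intro: determining_set_iso[OF assms(2,1) g])
  qed
  moreover have "(\<exists>S. generating_set G S \<and> finite S \<and> card S = n) \<longleftrightarrow>
        (\<exists>S. generating_set K S \<and> finite S \<and> card S = n)" for n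
  proof safe
    fix S assume "generating_set G S" "finite S"
    then show "\<exists>T. generating_set K T \<and> finite T \<and> card T = card S"
      by (intro exI[of _ "f ` S"])
        (auto simp: card_f generating_set_def[of G] intro: generating_set_iso[OF assms(1,2,3)])
  next
    fix S assume "generating_set K S" "finite S"
    then show "\<exists>T. generating_set G T \<and> finite T \<and> card T = card S"
      by (intro exI[of _ "?g ` S"])
        (auto simp: card_g generating_set_def[of K] intro: generating_set_iso[OF assms(2,1) g])
  qed
  ultimately show ?thesis
    using assms(2,4)
    by (simp add: DEG_group_def determining_number_def generating_number_def)
qed

text \<open>Numbering the elements moves any finite group onto the natural numbers.\<close>

lemma finite_group_iso_nat:
  fixes G :: "('a, 'b) monoid_scheme"
  assumes "group G" "finite (carrier G)"
  obtains K :: "nat monoid" and f where "group K" "f \<in> iso G K"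
proof -
  obtain f :: "'a \<Rightarrow> nat" where inj: "inj_on f (carrier G)"
    using finite_imp_inj_to_nat_seg[OF assms(2)] by auto
  interpret group G by fact
  define g where "g = inv_into (carrier G) f"
  define K where
    "K = \<lparr>carrier = f ` carrier G, monoid.mult = (\<lambda>x y. f (g x \<otimes>\<^bsub>G\<^esub> g y)), one = f \<one>\<^bsub>G\<^esub>\<rparr>"
  have gf: "g (f x) = x" if "x \<in> carrier G" for x
    using inj that by (simp add: g_def)
  have f: "f \<in> iso G K"
    using inj by (auto simp: iso_def hom_def bij_betw_def K_def gf)
  have "group (K\<lparr>one := f \<one>\<^bsub>G\<^esub>\<rparr>)"
    by (rule iso_imp_img_group[OF f])
  then have "group K" by (simp add: K_def)
  then show ?thesis using f that by blast
qed

section \<open>Determining sets of an elementary abelian group\<close>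

abbreviation coordinate_space :: "'i set \<Rightarrow> nat \<Rightarrow> ('i \<Rightarrow> int) monoid" where
  "coordinate_space I p \<equiv> product_group I (\<lambda>_. integer_mod_group p)"

definition unit_vec :: "'i set \<Rightarrow> 'i \<Rightarrow> 'i \<Rightarrow> int" where
  "unit_vec I j = (\<lambda>i\<in>I. if i = j then 1 else 0)"

lemma unit_vec_in_carrier: "p > 1 \<Longrightarrow> unit_vec I j \<in> carrier (coordinate_space I p)"
  by (auto simp: unit_vec_def carrier_integer_mod_group)

text \<open>Pigeonhole: there are more coefficient vectors modulo \<open>p\<close> than possible tuples of values
  on \<open>D\<close>, so two of them agree on \<open>D\<close>; their difference is the required functional.\<close>

lemma exists_annihilating_functional:
  fixes D :: "('i \<Rightarrow> int) set" and p :: nat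
  assumes "finite I" "finite D" "card D < card I" "p > 1"
  obtains a :: "'i \<Rightarrow> int" and j
  where "j \<in> I" "\<not> int p dvd a j" "\<And>d. d \<in> D \<Longrightarrow> int p dvd (\<Sum>i\<in>I. a i * d i)"
proof -
  let ?P = "{0..<int p}"
  let ?A = "I \<rightarrow>\<^sub>E ?P"
  define val where "val = (\<lambda>a. \<lambda>d\<in>D. (\<Sum>i\<in>I. a i * d i) mod int p)"
  have "val ` ?A \<subseteq> D \<rightarrow>\<^sub>E ?P"
    using assms(4) by (auto simp: val_def)
  moreover have fin: "finite (D \<rightarrow>\<^sub>E ?P)"
    using assms(2) by (simp add: finite_PiE)
  moreover have "card (D \<rightarrow>\<^sub>E ?P) < card ?A"
    using assms by (simp add: card_PiE)
  ultimately have "card (val ` ?A) < card ?A"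
    using card_mono[of "D \<rightarrow>\<^sub>E ?P" "val ` ?A"] by linarith
  then have "\<not> inj_on val ?A"
    by (rule pigeonhole)
  then obtain a b where ab: "a \<in> ?A" "b \<in> ?A" "val a = val b" "a \<noteq> b"
    by (auto simp: inj_on_def)
  then obtain j where j: "j \<in> I" "a j \<noteq> b j"
    by (metis PiE_ext)
  then have "a j \<in> ?P" "b j \<in> ?P"
    using ab by (auto simp: PiE_iff)
  then have "\<not> int p dvd a j - b j"
    using j(2) by (auto simp flip: mod_eq_dvd_iff)
  moreover have "int p dvd (\<Sum>i\<in>I. (a i - b i) * d i)" if "d \<in> D" for d
  proof -
    have "(\<Sum>i\<in>I. a i * d i) mod int p = (\<Sum>i\<in>I. b i * d i) mod int p"
      using fun_cong[OF ab(3), of d] that by (simp add: val_def)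
    then show ?thesis
      by (simp add: mod_eq_dvd_iff left_diff_distrib sum_subtractf)
  qed
  ultimately show ?thesis
    using that[of j "\<lambda>i. a i - b i"] j(1) by blast
qed

text \<open>With a nonzero functional \<open>\<phi>\<close> vanishing on \<open>D\<close> and a coordinate \<open>j\<close> with \<open>\<phi>(e\<^sub>j) \<noteq> 0\<close>, the
  map \<open>v \<mapsto> v + c \<phi>(v) e\<^sub>j\<close> fixes \<open>D\<close> and moves \<open>e\<^sub>j\<close>.  It scales \<open>\<phi>\<close> by \<open>1 + c \<phi>(e\<^sub>j)\<close>, so it is
  invertible as soon as this factor is nonzero.  As \<open>p\<close> is odd, one of \<open>c = 1\<close> and \<open>c = -1\<close>
  achieves that; for \<open>p = 2\<close> in dimension one the conclusion fails.\<close>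

lemma card_determining_set_coordinate_space:
  assumes "finite I" "prime p" "p > 2"
    and det: "determining_set (coordinate_space I p) D" and "finite D"
  shows "card I \<le> card D"
proof (rule ccontr)
  let ?V = "coordinate_space I p"
  assume "\<not> card I \<le> card D"
  then have few: "card D < card I" by simp
  have p1: "p > 1" using assms(3) by simp
  obtain a j where j: "j \<in> I" and aj: "\<not> int p dvd a j"
    and aD: "\<And>d. d \<in> D \<Longrightarrow> int p dvd (\<Sum>i\<in>I. a i * d i)"
    by (rule exists_annihilating_functional[OF assms(1,5) few p1]) (rule that)
  define phi where "phi v = (\<Sum>i\<in>I. a i * v i)" for v
  have p: "prime (int p)" using assms(2) by simp
  have carrier_V: "carrier ?V = I \<rightarrow>\<^sub>E {0..<int p}"
    using assms(3) by (simp add: carrier_integer_mod_group)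
  obtain c :: int where c: "c = 1 \<or> c = -1" "\<not> int p dvd 1 + c * a j"
  proof (cases "int p dvd 1 + a j")
    case True
    have "\<not> int p dvd 1 - a j"
    proof
      assume "int p dvd 1 - a j"
      with True have "int p dvd (1 + a j) + (1 - a j)" by (rule dvd_add)
      then show False using assms(3) zdvd_imp_le[of "int p" 2] by simp
    qed
    then show ?thesis using that[of "-1"] by simp
  qed (use that[of 1] in simp)
  have caj: "\<not> int p dvd c * a j"
    using aj c(1) by auto
  define f where
    "f = (\<lambda>v\<in>carrier ?V. \<lambda>i\<in>I. (v i + (if i = j then c * phi v else 0)) mod int p)"
  have f_hom: "f \<in> hom ?V ?V"
  proof (rule homI)
    fix x assume "x \<in> carrier ?V"
    then show "f x \<in> carrier ?V"
      using assms(3) by (simp add: f_def carrier_integer_mod_group)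
  next
    fix x y assume xy: "x \<in> carrier ?V" "y \<in> carrier ?V"
    interpret V: group ?V by simp
    have "phi (x \<otimes>\<^bsub>?V\<^esub> y) mod int p = (\<Sum>i\<in>I. a i * ((x i + y i) mod int p)) mod int p"
      by (simp add: phi_def)
    also have "\<dots> = (\<Sum>i\<in>I. (a i * ((x i + y i) mod int p)) mod int p) mod int p"
      by (simp add: mod_sum_eq)
    also have "\<dots> = (\<Sum>i\<in>I. (a i * (x i + y i)) mod int p) mod int p"
      by (simp add: mod_mult_right_eq)
    also have "\<dots> = (phi x + phi y) mod int p"
      by (simp add: mod_sum_eq phi_def distrib_left sum.distrib)
    finally have phi_add: "[phi (x \<otimes>\<^bsub>?V\<^esub> y) = phi x + phi y] (mod int p)"
      by (simp add: cong_def)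
    show "f (x \<otimes>\<^bsub>?V\<^esub> y) = f x \<otimes>\<^bsub>?V\<^esub> f y"
    proof (rule extensionalityI[of _ I])
      fix i assume i: "i \<in> I"
      let ?c = "\<lambda>t. if i = j then c * t else 0"
      have "f (x \<otimes>\<^bsub>?V\<^esub> y) i =
          ((x i + y i) mod int p + ?c (phi (x \<otimes>\<^bsub>?V\<^esub> y))) mod int p"
        using i V.m_closed[OF xy] by (simp add: f_def)
      also have "\<dots> = ((x i + y i) + ?c (phi x + phi y)) mod int p"
        unfolding cong_def[symmetric]
        using phi_add by (intro cong_add) (auto intro: cong_scalar_left)
      also have "\<dots> = ((x i + ?c (phi x)) + (y i + ?c (phi y))) mod int p"
        by (simp add: distrib_left add_ac)
      also have "\<dots> = (f x \<otimes>\<^bsub>?V\<^esub> f y) i"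
        using i xy by (simp add: f_def mod_add_eq)
      finally show "f (x \<otimes>\<^bsub>?V\<^esub> y) i = (f x \<otimes>\<^bsub>?V\<^esub> f y) i" .
    qed (use xy V.m_closed[OF xy] in \<open>auto simp: f_def\<close>)
  qed
  interpret f: group_hom ?V ?V f
    using f_hom by (simp add: group_hom_def group_hom_axioms_def)
  \<comment> \<open>A kernel vector is a multiple of \<open>e\<^sub>j\<close>, and on these \<open>f\<close> is scaling by \<open>1 + c \<phi>(e\<^sub>j)\<close>.\<close>
  have ker: "v = \<one>\<^bsub>?V\<^esub>" if v: "v \<in> carrier ?V" and fv: "f v = \<one>\<^bsub>?V\<^esub>" for v
  proof -
    have eq0: "(v i + (if i = j then c * phi v else 0)) mod int p = 0" if "i \<in> I" for i
      using fun_cong[OF fv, of i] that v by (simp add: f_def)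
    have small: "v i = 0" if "i \<in> I" "int p dvd v i" for i
      using that v zdvd_imp_le[of "int p" "v i"] unfolding carrier_V by (force simp: PiE_iff)
    have v_other: "v i = 0" if "i \<in> I" "i \<noteq> j" for i
      using eq0[OF that(1)] that small by auto
    then have "phi v = (\<Sum>i\<in>I. if i = j then a j * v j else 0)"
      unfolding phi_def by (intro sum.cong) auto
    then have "phi v = a j * v j"
      using j assms(1) by simp
    then have "int p dvd (1 + c * a j) * v j"
      using eq0[OF j] by (simp add: mod_eq_0_iff_dvd algebra_simps)
    then have "int p dvd v j"
      using p c(2) by (simp add: prime_dvd_mult_iff)
    then have "v j = 0" using small j by blast
    with v_other have "v i = 0" if "i \<in> I" for i using that by metis
    then show ?thesis
      using v by (intro extensionalityI[of _ I]) (auto simp: PiE_iff)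
  qed
  have inj: "inj_on f (carrier ?V)"
    using ker by (simp add: f.inj_on_one_iff del: carrier_product_group one_product_group)
  have "finite (carrier ?V)"
    unfolding carrier_V using assms(1) by (simp add: finite_PiE)
  then have "f ` carrier ?V = carrier ?V"
    using endo_inj_surj[OF _ _ inj] f.hom_closed by blast
  then have "f \<in> auto ?V"
    using f_hom inj by (simp add: auto_def Bij_def bij_betw_def f_def)
  moreover have "\<forall>d\<in>D. f d = d"
  proof
    fix d assume d: "d \<in> D"
    then have dV: "d \<in> carrier ?V"
      using det unfolding determining_set_def by blast
    have "int p dvd c * phi d"
      using aD[OF d] by (simp add: phi_def)
    then have "(d i + (if i = j then c * phi d else 0)) mod int p = d i mod int p" for i
      by (auto simp: mod_eq_dvd_iff)
    moreover have "d i mod int p = d i" if "i \<in> I" for i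
      using dV that unfolding carrier_V by (simp add: PiE_iff)
    ultimately show "f d = d"
      using dV by (intro extensionalityI[of _ I]) (auto simp: f_def PiE_iff)
  qed
  ultimately have "f = (\<lambda>x\<in>carrier ?V. x)"
    using det by (simp add: determining_set_def)
  then have "f (unit_vec I j) j = unit_vec I j j"
    using unit_vec_in_carrier[of p I j] assms(3) by simp
  moreover have "phi (unit_vec I j) = a j"
    using j assms(1) by (simp add: phi_def unit_vec_def if_distrib[of "\<lambda>t. _ * t"] cong: if_cong)
  ultimately have "(1 + c * a j) mod int p = 1 mod int p"
    using j unit_vec_in_carrier[of p I j] assms(3) by (simp add: f_def unit_vec_def)
  then have "int p dvd c * a j"
    by (simp add: mod_eq_dvd_iff)
  with caj show False by blast
qed

section \<open>Direct products\<close>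

text \<open>An automorphism of \<open>B\<close> extends to the product by the identity on \<open>A\<close>.\<close>

lemma determining_set_snd:
  assumes "group A" "group B" "determining_set (A \<times>\<times> B) D"
  shows "determining_set B (snd ` D)"
  unfolding determining_set_def
proof (intro conjI ballI impI)
  have D: "D \<subseteq> carrier A \<times> carrier B"
    using assms(3) by (simp add: determining_set_def)
  then show "snd ` D \<subseteq> carrier B" by auto
  fix s assume s: "s \<in> auto B" and fix_D: "\<forall>d\<in>snd ` D. s d = d"
  define t where "t = restrict (\<lambda>(x, y). (x, s y)) (carrier (A \<times>\<times> B))"
  have "(\<lambda>(x, y). (x, s y)) \<in> iso (A \<times>\<times> B) (A \<times>\<times> B)"
    using assms s by (simp add: iso_paired2 auto_iff iso_set_refl)
  then have "t \<in> auto (A \<times>\<times> B)"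
    unfolding t_def by (rule restrict_iso_in_auto[OF DirProd_group[OF assms(1,2)]])
  moreover have "\<forall>d\<in>D. t d = d"
    using D fix_D by (force simp: t_def)
  ultimately have t: "t = (\<lambda>x\<in>carrier (A \<times>\<times> B). x)"
    using assms(3) by (simp add: determining_set_def)
  have "s y = y" if "y \<in> carrier B" for y
    using fun_cong[OF t, of "(\<one>\<^bsub>A\<^esub>, y)"] that assms(1)
    by (simp add: t_def group.is_monoid)
  then show "s = (\<lambda>x\<in>carrier B. x)"
    using s by (intro extensionalityI[of _ "carrier B"]) (auto simp: auto_iff)
qed

text \<open>By the Chinese remainder theorem some exponent is \<open>1\<close> modulo the order of \<open>A\<close> and \<open>0\<close>
  modulo the order of \<open>B\<close>; raising to that power projects onto the first factor.\<close>

lemma subgroup_DirProd_coprime_fst: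
  assumes "group A" "group B" "coprime (order A) (order B)"
    and K: "subgroup K (A \<times>\<times> B)" and ab: "(a, b) \<in> K"
  shows "(a, \<one>\<^bsub>B\<^esub>) \<in> K"
proof -
  interpret A: group A by fact
  interpret B: group B by fact
  interpret P: group "A \<times>\<times> B" using assms by (intro DirProd_group)
  have a: "a \<in> carrier A" and b: "b \<in> carrier B"
    using subgroup.mem_carrier[OF K ab] by auto
  obtain k where k: "[k = 1] (mod order A)" "[k = 0] (mod order B)"
    using binary_chinese_remainder_nat[OF assms(3), of 1 0] by auto
  have pow: "(a, b) [^]\<^bsub>A \<times>\<times> B\<^esub> n = (a [^]\<^bsub>A\<^esub> n, b [^]\<^bsub>B\<^esub> n)" for n :: nat
    by (induction n) auto
  have "b [^]\<^bsub>B\<^esub> k = \<one>\<^bsub>B\<^esub>"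
  proof -
    obtain m where "k = order B * m"
      using k(2) by (auto simp: cong_0_iff)
    then show ?thesis
      using B.pow_order_eq_1[OF b] b by (metis B.nat_pow_pow B.nat_pow_one)
  qed
  moreover have "a [^]\<^bsub>A\<^esub> k = a"
  proof -
    have "int (A.ord a) dvd int k - int 1"
      using k(1) A.ord_dvd_group_order[OF a]
      by (metis cong_dvd_modulus_nat cong_int_iff cong_iff_dvd_diff)
    then have "a [^]\<^bsub>A\<^esub> (int k - int 1) = \<one>\<^bsub>A\<^esub>"
      using a by (simp only: A.int_pow_eq_id)
    then have "a [^]\<^bsub>A\<^esub> int k = a [^]\<^bsub>A\<^esub> int 1"
      using a by (metis A.int_pow_diff A.int_pow_closed A.inv_solve_right A.l_one A.one_closed)
    then show ?thesis
      using a by (simp add: int_pow_int)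
  qed
  moreover have "(a, b) [^]\<^bsub>A \<times>\<times> B\<^esub> k \<in> K"
    using P.subgroup_int_pow_closed[OF K ab, of "int k"] by (simp add: int_pow_int)
  ultimately show ?thesis by (simp add: pow)
qed

lemma generate_unit_vecs:
  assumes "finite I" "p > 1"
  shows "generate (coordinate_space I p) (unit_vec I ` I) = carrier (coordinate_space I p)"
    (is "generate ?V _ = _")
proof
  interpret V: group ?V by simp
  have unit: "unit_vec I ` I \<subseteq> carrier ?V"
    using unit_vec_in_carrier[OF assms(2)] by (intro image_subsetI)
  let ?L = "generate ?V (unit_vec I ` I)"
  have L: "subgroup ?L ?V"
    by (rule V.generate_is_subgroup[OF unit])
  show "?L \<subseteq> carrier ?V"
    by (rule V.generate_incl[OF unit])
  have pow: "x [^]\<^bsub>?V\<^esub> m = (\<lambda>i\<in>I. (int m * x i) mod int p)" for x and m :: nat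
    by (induction m) (auto simp: fun_eq_iff mod_add_left_eq mod_add_right_eq distrib_right add.commute)
  show "carrier ?V \<subseteq> ?L"
  proof
    fix v assume v: "v \<in> carrier ?V"
    have v_range: "0 \<le> v i" "v i < int p" if "i \<in> I" for i
      using v that assms(2) by (auto simp: PiE_iff carrier_integer_mod_group)
    \<comment> \<open>Build up \<open>v\<close> one coordinate at a time.\<close>
    have "(\<lambda>i\<in>I. if i \<in> J then v i else 0) \<in> ?L" if "J \<subseteq> I" for J
      using finite_subset[OF that assms(1)] that
    proof (induction J rule: finite_induct)
      case empty
      then show ?case using subgroup.one_closed[OF L] by (simp add: restrict_def)
    next
      case (insert j J)
      let ?w = "\<lambda>i\<in>I. if i \<in> J then v i else 0"
      have "unit_vec I j [^]\<^bsub>?V\<^esub> nat (v j) \<in> ?L"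
        using V.subgroup_int_pow_closed[OF L, of "unit_vec I j" "int (nat (v j))"] insert.prems
        unfolding int_pow_int by (auto intro: generate.incl)
      then have "?w \<otimes>\<^bsub>?V\<^esub> unit_vec I j [^]\<^bsub>?V\<^esub> nat (v j) \<in> ?L"
        using insert.IH insert.prems by (blast intro: subgroup.m_closed[OF L])
      also have "?w \<otimes>\<^bsub>?V\<^esub> unit_vec I j [^]\<^bsub>?V\<^esub> nat (v j) =
          (\<lambda>i\<in>I. if i \<in> insert j J then v i else 0)"
        using v_range insert.hyps(2) by (auto simp: fun_eq_iff pow unit_vec_def)
      finally show ?case .
    qed
    from this[OF order_refl] have "(\<lambda>i\<in>I. v i) \<in> ?L"
      by (simp cong: restrict_cong)
    then show "v \<in> ?L"
      using v by (simp add: PiE_restrict)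
  qed
qed

lemma order_coordinate_space:
  "finite I \<Longrightarrow> p > 0 \<Longrightarrow> order (coordinate_space I p) = p ^ card I"
  by (simp add: order_def carrier_integer_mod_group card_PiE)

section \<open>The construction\<close>

text \<open>The pairs \<open>(h, e\<^sub>h)\<close> generate the first factor, because coprimality splits off their first
  components; dividing by these leaves all unit vectors of the second factor.  There are as many
  pairs as dimensions of the second factor, which every determining set must at least match.\<close>

lemma DEG_group_DirProd_coordinate_space:
  assumes "group H" "finite (carrier H)" "prime p" "p > 2" "p > order H"
  shows "DEG_group (H \<times>\<times> coordinate_space (carrier H) p)" (is "DEG_group (H \<times>\<times> ?V)")
proof -
  let ?I = "carrier H"
  let ?G = "H \<times>\<times> ?V"
  define S where "S = (\<lambda>h. (h, unit_vec ?I h)) ` ?I"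
  interpret H: group H by fact
  interpret V: group ?V by simp
  interpret G: group ?G by (intro DirProd_group) auto
  have card_S: "card S = card ?I"
    unfolding S_def by (intro card_image) (auto simp: inj_on_def)
  have fin: "finite S" using assms(2) by (simp add: S_def)
  have S: "S \<subseteq> carrier ?G"
    using unit_vec_in_carrier[of p ?I] assms(4) unfolding S_def by fastforce
  have "coprime (order H) p"
  proof -
    have "order H > 0" using assms(2) H.order_gt_0_iff_finite by blast
    then have "\<not> p dvd order H" using assms(5) by (auto dest: dvd_imp_le)
    then show ?thesis using assms(3) by (simp add: prime_imp_coprime coprime_commute)
  qed
  then have cop: "coprime (order H) (order ?V)"
    using assms(2,4) by (simp add: order_coordinate_space)
  define L where "L = generate ?G S"
  have L: "subgroup L ?G" unfolding L_def by (rule G.generate_is_subgroup[OF S])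
  have L1: "(h, \<one>\<^bsub>?V\<^esub>) \<in> L" if "h \<in> ?I" for h
  proof (rule subgroup_DirProd_coprime_fst[OF H.is_group V.is_group cop L])
    show "(h, unit_vec ?I h) \<in> L"
      unfolding L_def by (rule generate.incl) (use that in \<open>simp add: S_def\<close>)
  qed
  interpret inj2: group_hom ?V ?G "\<lambda>v. (\<one>\<^bsub>H\<^esub>, v)"
    by unfold_locales (auto simp: hom_def Pi_iff)
  have unit: "(\<one>\<^bsub>H\<^esub>, unit_vec ?I h) \<in> L" if "h \<in> ?I" for h
  proof -
    have u: "unit_vec ?I h \<in> carrier ?V"
      using unit_vec_in_carrier[of p ?I h] assms(4) by linarith
    have "(h, unit_vec ?I h) \<in> L"
      unfolding L_def by (rule generate.incl) (use that in \<open>simp add: S_def\<close>)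
    then have "inv\<^bsub>?G\<^esub> (h, \<one>\<^bsub>?V\<^esub>) \<otimes>\<^bsub>?G\<^esub> (h, unit_vec ?I h) \<in> L"
      by (intro subgroup.m_closed[OF L] subgroup.m_inv_closed[OF L] L1 that)
    also have "inv\<^bsub>?G\<^esub> (h, \<one>\<^bsub>?V\<^esub>) \<otimes>\<^bsub>?G\<^esub> (h, unit_vec ?I h) = (\<one>\<^bsub>H\<^esub>, unit_vec ?I h)"
      using that u
      by (simp add: inv_DirProd[OF H.is_group V.is_group] H.l_inv V.l_one
          del: carrier_product_group one_product_group mult_product_group)
    finally show ?thesis .
  qed
  have L2: "(\<one>\<^bsub>H\<^esub>, v) \<in> L" if "v \<in> carrier ?V" for v
  proof -
    have "generate ?G ((\<lambda>v. (\<one>\<^bsub>H\<^esub>, v)) ` unit_vec ?I ` ?I) = (\<lambda>v. (\<one>\<^bsub>H\<^esub>, v)) ` carrier ?V"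
      using inj2.generate_img[of "unit_vec ?I ` ?I"] generate_unit_vecs[of ?I p]
        unit_vec_in_carrier[of p ?I] assms(2,4) by auto
    moreover have "generate ?G ((\<lambda>v. (\<one>\<^bsub>H\<^esub>, v)) ` unit_vec ?I ` ?I) \<subseteq> L"
      using unit by (intro G.generate_subgroup_incl[OF _ L]) auto
    ultimately show ?thesis using that by blast
  qed
  have "carrier ?G \<subseteq> L"
  proof
    fix x assume "x \<in> carrier ?G"
    then obtain h v where x: "x = (h, v)" and h: "h \<in> ?I" and v: "v \<in> carrier ?V" by auto
    have "(h, \<one>\<^bsub>?V\<^esub>) \<otimes>\<^bsub>?G\<^esub> (\<one>\<^bsub>H\<^esub>, v) \<in> L"
      by (rule subgroup.m_closed[OF L L1[OF h] L2[OF v]])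
    also have "(h, \<one>\<^bsub>?V\<^esub>) \<otimes>\<^bsub>?G\<^esub> (\<one>\<^bsub>H\<^esub>, v) = x"
      using h v x H.r_one V.l_one
      by (simp del: carrier_product_group one_product_group mult_product_group)
    finally show "x \<in> L" .
  qed
  then have gen: "generating_set ?G S"
    using S subgroup.subset[OF L] by (auto simp: generating_set_def L_def)
  show ?thesis
  proof (rule DEG_groupI[OF G.is_group gen fin])
    fix D assume D: "determining_set ?G D" "finite D"
    have "card ?I \<le> card (snd ` D)"
      using assms(2-4) D determining_set_snd[OF H.is_group V.is_group D(1)]
      by (intro card_determining_set_coordinate_space) auto
    also have "\<dots> \<le> card D"
      by (rule card_image_le[OF D(2)])
    finally show "card S \<le> card D" by (simp add: card_S)
  qed
qed

theorem lemma5p8: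
  fixes H :: "('a, 'b) monoid_scheme"
  assumes "group H" and "finite (carrier H)"
  shows "\<exists>G :: nat monoid. finite (carrier G) \<and> DEG_group G \<and>
           (\<exists>N. N \<lhd> G \<and> H \<cong> G\<lparr>carrier := N\<rparr>)"
proof -
  obtain p :: nat where p: "prime p" "p > max 2 (order H)"
    using bigger_prime by blast
  let ?V = "coordinate_space (carrier H) p"
  let ?G = "H \<times>\<times> ?V"
  interpret H: group H by fact
  interpret V: group ?V by simp
  interpret G: group ?G by (intro DirProd_group) auto
  have DEG: "DEG_group ?G"
    using assms p by (intro DEG_group_DirProd_coordinate_space) auto
  have fin: "finite (carrier ?G)"
    using assms(2) p by (simp add: finite_PiE carrier_integer_mod_group)
  obtain K :: "nat monoid" and f where K: "group K" and f: "f \<in> iso ?G K"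
    using finite_group_iso_nat[OF G.is_group fin] by blast
  define N where "N = carrier H \<times> {\<one>\<^bsub>?V\<^esub>}"
  have N: "N \<lhd> ?G"
    unfolding N_def
    by (intro H.DirProd_normal V.is_group H.normal_self V.one_is_normal)
  have "(\<lambda>h. (h, \<one>\<^bsub>?V\<^esub>)) \<in> iso H (?G\<lparr>carrier := N\<rparr>)"
    using V.l_one[OF V.one_closed] by (auto simp: iso_def hom_def bij_betw_def inj_on_def N_def)
  moreover have "restrict f N \<in> iso (?G\<lparr>carrier := N\<rparr>) (K\<lparr>carrier := f ` N\<rparr>)"
    by (rule iso_restrict[OF f G.is_group K normal_imp_subgroup[OF N]])
  ultimately have "H \<cong> K\<lparr>carrier := f ` N\<rparr>"
    using iso_trans is_isoI by metis
  moreover have "f ` N \<lhd> K"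
    by (rule iso_normal_subgroup[OF f G.is_group K N])
  moreover have "finite (carrier K)"
    using iso_finite[OF is_isoI[OF f]] fin by simp
  moreover have "DEG_group K"
    by (rule DEG_group_iso[OF G.is_group K f DEG])
  ultimately show ?thesis by blast
qed

end
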